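(* Let $\alpha\approx 1.46557123$ be the unique real root of $X^3-X^2-1$. Let $(a(j))_{j\ge1}$ be the increasing enumeration of the positive integers $k$ such that $(k)_N$ ends in a $1$ followed by exactly $3s$ or $3s+2$ zeros for some $s\ge0$, and let $(b(j))_{j\ge1}$ be the increasing enumeration of the positive integers $k$ such that $(k)_N$ ends in a $1$ followed by exactly $3s+1$ zeros for some $s\ge 0$. Then (i) $-1.2630921 < a(i)-\alpha i < 0.58304372$ for all $i\ge 1$; (ii) $-2.2480941 < b(i)-\alpha^3 i < 0.558039$ for all $i\ge1$.
   Context: The Narayana numbers $(N_i)_{i\in\mathbb Z}$ are defined by $N_0=1$, $N_1=2$, $N_2=3$ and $N_i=N_{i-1}+N_{i-3}$ for all integers $i$ (so $N_{-1}=N_{-2}=1$, $N_3=4$, $N_4=6$, $N_5=9,\dots$). Every nonnegative integer $m$ has a unique Narayana representation $(m)_N=e_1\cdots e_t\in\{0,1\}^*$ with $m=\sum_{i=1}^t e_iN_{t-i}$, $e_1=1$ when $t\ge1$, and containing no factor $11$ or $101$; $(0)_N$ is the empty word. *)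

theory Defs
  imports Complex_Main "HOL-Library.Infinite_Set" "HOL-Library.Sublist"
begin

text \<open>Only indices \<open>i \<ge> 0\<close> occur in Narayana representations, so the two-sided
  sequence is restricted to the natural numbers.\<close>

fun narayana :: "nat \<Rightarrow> nat" where
  "narayana 0 = 1"
| "narayana (Suc 0) = 2"
| "narayana (Suc (Suc 0)) = 3"
| "narayana (Suc (Suc (Suc i))) = narayana (Suc (Suc i)) + narayana i"

text \<open>Words are written most significant digit first; the digit \<open>e\<^sub>i\<close> of
  \<open>e\<^sub>1 \<dots> e\<^sub>t\<close> is \<open>w ! (i - 1)\<close>.\<close>

definition is_narayana_rep :: "nat list \<Rightarrow> nat \<Rightarrow> bool" where
  "is_narayana_rep w m \<longleftrightarrow>
     set w \<subseteq> {0, 1} \<and>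
     m = (\<Sum>i = 1..length w. w ! (i - 1) * narayana (length w - i)) \<and>
     (w \<noteq> [] \<longrightarrow> hd w = 1) \<and>
     \<not> sublist [1, 1] w \<and> \<not> sublist [1, 0, 1] w"

definition narayana_rep :: "nat \<Rightarrow> nat list" where
  "narayana_rep m = (THE w. is_narayana_rep w m)"

definition ends_one_zeros :: "nat list \<Rightarrow> nat \<Rightarrow> bool" where
  "ends_one_zeros w z \<longleftrightarrow> (\<exists>u. w = u @ [1] @ replicate z 0)"

definition setA :: "nat set" where
  "setA = {k. k > 0 \<and> (\<exists>s. ends_one_zeros (narayana_rep k) (3 * s) \<or>
                             ends_one_zeros (narayana_rep k) (3 * s + 2))}"

definition setB :: "nat set" where
  "setB = {k. k > 0 \<and> (\<exists>s. ends_one_zeros (narayana_rep k) (3 * s + 1))}"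

text \<open>The library enumeration of an infinite set of natural numbers starts at index \<open>0\<close>;
  the sequences here are indexed by \<open>j \<ge> 1\<close>.\<close>

definition seqA :: "nat \<Rightarrow> nat" where
  "seqA j = enumerate setA (j - 1)"

definition seqB :: "nat \<Rightarrow> nat" where
  "seqB j = enumerate setB (j - 1)"

definition alpha :: real where
  "alpha = (THE x::real. x ^ 3 - x ^ 2 - 1 = 0)"

end

theory Submission
  imports Defs
begin

text \<open>
  Let $r(k)$ count the elements of the first set up to $k$ and let $E(k) = k - \alpha r(k)$. Prepending
  a leading digit does not change how a representation ends, so $r$ and $E$ are additive over the
  digits: $E(k) = \sum_p d_p$ over the positions $p$ of the ones, where $d_p = E(N_p)$ satisfies the
  Narayana recurrence. Its component along $\alpha$ vanishes, so $d_p$ decays like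
  $\alpha^{-p/2}$. As ones are at least three positions apart, the extreme values of
  $\sum_p d_p$ obey the recursion $M_{n+3} = \max(M_{n+2}, M_n + d_{n+2})$; thirty rational steps of
  it and a geometric tail give $-1.2598 < E(k) < 1.0466$ for all $k$. For $k$ in the first set
  $E(k) = E(k-1) + 1 - \alpha$, and for $k$ in the second one $E(k) = E(k-1) + 1$, which improves one
  side of the bound in each case. Since the ranks in the two sets add up to $k$, the error in the
  second claim equals $-\alpha^2 E(k)$.
\<close>

section \<open>Words and representations\<close>

definition word_value :: "nat list \<Rightarrow> nat" where
  "word_value w = (\<Sum>i = 1..length w. w ! (i - 1) * narayana (length w - i))"

text \<open>Leading zeros are allowed here, unlike in \<open>is_narayana_rep\<close>, so that words
  can be padded to a common length and compared digit by digit.\<close>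

definition admissible :: "nat list \<Rightarrow> bool" where
  "admissible w \<longleftrightarrow> set w \<subseteq> {0, 1} \<and> \<not> sublist [1, 1] w \<and> \<not> sublist [1, 0, 1] w"

lemma word_value_Nil [simp]: "word_value [] = 0"
  by (simp add: word_value_def)

lemma word_value_Cons [simp]: "word_value (a # w) = a * narayana (length w) + word_value w"
proof -
  have "word_value (a # w) = a * narayana (length w) +
      (\<Sum>i = Suc 1..Suc (length w). (a # w) ! (i - 1) * narayana (Suc (length w) - i))"
    unfolding word_value_def by (subst sum.atLeast_Suc_atMost) auto
  also have "(\<Sum>i = Suc 1..Suc (length w). (a # w) ! (i - 1) * narayana (Suc (length w) - i))
      = word_value w"
    unfolding word_value_def sum.shift_bounds_cl_Suc_ivl
    by (rule sum.cong) (auto simp: nth_Cons split: nat.splits)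
  finally show ?thesis .
qed

lemma word_value_replicate_0 [simp]: "word_value (replicate n 0) = 0"
  by (induction n) auto

lemma word_value_padded [simp]: "word_value (replicate n 0 @ w) = word_value w"
  by (induction n) auto

lemma admissible_Nil [simp]: "admissible []"
  by (simp add: admissible_def)

lemma admissible_Cons_0 [simp]: "admissible (0 # w) \<longleftrightarrow> admissible w"
  by (auto simp: admissible_def sublist_Cons_right)

lemma admissible_Cons_1:
  "admissible (1 # w) \<longleftrightarrow> admissible w \<and> \<not> prefix [1] w \<and> \<not> prefix [0, 1] w"
  by (auto simp: admissible_def sublist_Cons_right)

lemma admissible_100 [simp]: "admissible (1 # 0 # 0 # w) \<longleftrightarrow> admissible w"
  by (simp add: admissible_Cons_1 del: One_nat_def)

lemma admissible_padded [simp]: "admissible (replicate n 0 @ w) \<longleftrightarrow> admissible w"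
  by (induction n) auto

text \<open>After a 1 the next two digits, as far as they exist, must be 0. Removing 0 or 100 from
  the front therefore drives the later inductions.\<close>

lemma admissible_cases:
  assumes "admissible w"
  obtains "w = []" | "w = [1]" | "w = [1, 0]"
    | v where "w = 0 # v" "admissible v" | v where "w = 1 # 0 # 0 # v" "admissible v"
proof (cases w)
  case (Cons a u)
  then have "a = 0 \<or> a = 1" using assms by (auto simp: admissible_def)
  then show ?thesis
  proof
    assume "a = 0"
    then show ?thesis using that(4) assms Cons by simp
  next
    assume a: "a = 1"
    then have u: "admissible u" "\<not> prefix [1] u" "\<not> prefix [0, 1] u"
      using assms Cons admissible_Cons_1 by auto
    have dig: "set u \<subseteq> {0, 1}" using u(1) by (simp add: admissible_def)
    show ?thesis
    proof (cases u)
      case Nil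
      then show ?thesis using that(2) a Cons by simp
    next
      case (Cons b v)
      then have b: "b = 0" using dig u by auto
      show ?thesis
      proof (cases v)
        case Nil
        then show ?thesis using that(3) a b \<open>w = a # u\<close> Cons by simp
      next
        case (Cons c x)
        then have "c = 0" using dig u b \<open>u = b # v\<close> by auto
        then show ?thesis using that(5) a b u \<open>w = a # u\<close> \<open>u = b # v\<close> Cons by simp
      qed
    qed
  qed
qed (use that in simp)

section \<open>Existence and uniqueness of representations\<close>

lemma narayana_pos [simp]: "narayana n > 0"
  by (induction n rule: narayana.induct) auto

lemma narayana_Suc_Suc_Suc_eq:
  "narayana (n + 3) = narayana (n + 2) + narayana n"
  by (simp add: numeral_3_eq_3)

lemma narayana_less_Suc: "narayana n < narayana (Suc n)"
proof -
  consider "n = 0" | "n = 1" | m where "n = Suc (Suc m)"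
    by (metis One_nat_def not0_implies_Suc)
  then show ?thesis by cases (auto simp: numeral_2_eq_2)
qed

lemma strict_mono_narayana: "strict_mono narayana"
  by (simp add: strict_mono_Suc_iff narayana_less_Suc)

lemma less_narayana: "n < narayana n"
proof (induction n)
  case (Suc n)
  then show ?case using narayana_less_Suc[of n] by linarith
qed simp

lemma word_value_less:
  assumes "admissible w"
  shows "word_value w < narayana (length w)"
  using assms
proof (induction "length w" arbitrary: w rule: less_induct)
  case less
  from less.prems show ?case
  proof (cases rule: admissible_cases)
    case (4 v)
    then have "word_value v < narayana (length v)" using less by simp
    then show ?thesis using 4 narayana_less_Suc[of "length v"] by simp
  next
    case (5 v)
    then have "word_value v < narayana (length v)" using less by simp
    then show ?thesis using 5 by simp
  qed auto
qed

lemma admissible_tl: "admissible (a # w) \<Longrightarrow> admissible w"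
  by (auto simp: admissible_def sublist_Cons_right)

text \<open>By \<open>word_value_less\<close> the tails contribute less than the weight of the
  leading position, so the leading digits must agree.\<close>

lemma word_value_inject:
  assumes "admissible v" "admissible w" "length v = length w" "word_value v = word_value w"
  shows "v = w"
  using assms(3,1,2,4)
proof (induction v w rule: list_induct2)
  case (Cons a v b w)
  have ab: "a \<in> {0, 1}" "b \<in> {0, 1}" using Cons.prems by (auto simp: admissible_def)
  have adm: "admissible v" "admissible w" using Cons.prems admissible_tl by blast+
  have "word_value v < narayana (length v)" "word_value w < narayana (length w)"
    using adm word_value_less by auto
  then have "a = b" using ab Cons.prems Cons.hyps by auto
  then show ?case using Cons adm by simp
qed simp

text \<open>Greedy expansion: once the largest available Narayana number is subtracted, the
  remainder is small enough to leave room for the two zeros that must follow.\<close>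

lemma word_value_exists:
  assumes "m < narayana n"
  obtains w where "admissible w" "length w = n" "word_value w = m"
proof -
  have "\<exists>w. admissible w \<and> length w = n \<and> word_value w = m"
    using assms
  proof (induction n arbitrary: m rule: narayana.induct)
    case 1
    then show ?case by (intro exI[of _ "[]"]) auto
  next
    case 2
    then have "m = 0 \<or> m = 1" by auto
    then show ?case
      by (elim disjE; intro exI[of _ "[m]"])
        (auto simp: admissible_Cons_1 simp del: One_nat_def)
  next
    case 3
    then have "m = 0 \<or> m = 1 \<or> m = 2" by auto
    then show ?case
      \<comment> \<open>The two lowest weights are 2 and 1, so two-digit words are read in binary;
        the value 3 does not occur.\<close>
      by (elim disjE; intro exI[of _ "[m div 2, m mod 2]"])
        (auto simp: admissible_Cons_1 simp del: One_nat_def)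
  next
    case (4 n)
    show ?case
    proof (cases "m < narayana (Suc (Suc n))")
      case True
      then obtain w where "admissible w" "length w = Suc (Suc n)" "word_value w = m"
        using 4 by blast
      then show ?thesis by (intro exI[of _ "0 # w"]) simp
    next
      case False
      then have "m - narayana (Suc (Suc n)) < narayana n" using "4.prems" by auto
      then obtain w where "admissible w" "length w = n"
          "word_value w = m - narayana (Suc (Suc n))"
        using "4.IH" by blast
      then show ?thesis using False by (intro exI[of _ "1 # 0 # 0 # w"]) (simp del: One_nat_def)
    qed
  qed
  then show ?thesis using that by blast
qed

lemma dropWhile_padded: "w = [] \<or> hd w = 1 \<Longrightarrow> dropWhile ((=) 0) (replicate n (0::nat) @ w) = w"
  by (induction n) (cases w; auto)+

lemma padded_dropWhile:
  "replicate (length w - length (dropWhile ((=) 0) w)) 0 @ dropWhile ((=) (0::nat)) w = w"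
proof (induction w)
  case (Cons a w)
  then show ?case
    by (cases "a = 0") (simp_all add: Suc_diff_le length_dropWhile_le)
qed simp

lemma is_narayana_rep_iff:
  "is_narayana_rep w m \<longleftrightarrow> admissible w \<and> word_value w = m \<and> (w = [] \<or> hd w = 1)"
  by (auto simp: is_narayana_rep_def admissible_def word_value_def)

lemma narayana_rep_word_value:
  assumes "admissible w"
  shows "narayana_rep (word_value w) = dropWhile ((=) 0) w"
  unfolding narayana_rep_def
proof (rule the_equality)
  let ?u = "dropWhile ((=) 0) w"
  have "admissible ?u" "word_value ?u = word_value w"
    using assms padded_dropWhile[of w] by (metis admissible_padded, metis word_value_padded)
  moreover have "?u = [] \<or> hd ?u = 1"
  proof (cases "?u = []")
    case False
    then have "hd ?u \<noteq> 0" using hd_dropWhile[OF False] by simp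
    moreover have "hd ?u \<in> {0, 1}"
      using \<open>admissible ?u\<close> False list.set_sel(1) unfolding admissible_def by blast
    ultimately show ?thesis by simp
  qed simp
  ultimately show "is_narayana_rep ?u (word_value w)"
    by (simp add: is_narayana_rep_iff)
next
  fix v assume v: "is_narayana_rep v (word_value w)"
  \<comment> \<open>Mutual padding with zeros gives both words the same length, as
    \<open>word_value_inject\<close> requires.\<close>
  let ?v = "replicate (length w) 0 @ v" and ?w = "replicate (length v) 0 @ w"
  have "?v = ?w"
    using v assms by (intro word_value_inject) (auto simp: is_narayana_rep_iff)
  moreover have "dropWhile ((=) 0) ?v = v"
    using v by (intro dropWhile_padded) (simp add: is_narayana_rep_iff)
  moreover have "dropWhile ((=) 0) ?w = dropWhile ((=) 0) w"
    by (rule dropWhile_append2) auto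
  ultimately show "v = dropWhile ((=) 0) w" by simp
qed

section \<open>Trailing zeros\<close>

lemma ends_one_zeros_Nil [simp]: "\<not> ends_one_zeros [] z"
  by (simp add: ends_one_zeros_def)

lemma ends_one_zeros_Cons:
  "ends_one_zeros (a # w) z \<longleftrightarrow> ends_one_zeros w z \<or> a = 1 \<and> w = replicate z 0"
proof
  assume "ends_one_zeros (a # w) z"
  then obtain u where "a # w = u @ [1] @ replicate z 0" by (auto simp: ends_one_zeros_def)
  then show "ends_one_zeros w z \<or> a = 1 \<and> w = replicate z 0"
    by (cases u) (auto simp: ends_one_zeros_def)
next
  assume "ends_one_zeros w z \<or> a = 1 \<and> w = replicate z 0"
  then show "ends_one_zeros (a # w) z"
    unfolding ends_one_zeros_def by (metis append_Cons append_Nil)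
qed

lemma ends_one_zeros_replicate_0 [simp]: "\<not> ends_one_zeros (replicate n 0) z"
  by (induction n) (auto simp: ends_one_zeros_Cons)

lemma ends_one_zeros_dropWhile:
  "ends_one_zeros (dropWhile ((=) 0) w) z \<longleftrightarrow> ends_one_zeros w z"
  by (induction w) (auto simp: ends_one_zeros_Cons)

lemma ends_one_zeros_unique:
  "ends_one_zeros w z \<Longrightarrow> ends_one_zeros w z' \<Longrightarrow> z = z'"
proof (induction w)
  case (Cons a w)
  then show ?case
    by (auto simp: ends_one_zeros_Cons)
qed simp

lemma ends_one_zeros_exists:
  assumes "admissible w" "word_value w > 0"
  shows "\<exists>z. ends_one_zeros w z"
  using assms
proof (induction w)
  case (Cons a w)
  show ?case
  proof (cases "word_value w = 0")
    case True
    have "word_value (replicate (length w) 0) = word_value w" using True by simp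
    then have "replicate (length w) 0 = w"
      using admissible_tl[OF Cons.prems(1)] admissible_padded[of "length w" "[]"]
      by (intro word_value_inject) simp_all
    moreover have "a = 1" using Cons.prems True by (auto simp: admissible_def)
    ultimately show ?thesis by (metis ends_one_zeros_Cons)
  next
    case False
    then show ?thesis
      using Cons.IH admissible_tl[OF Cons.prems(1)] by (auto simp: ends_one_zeros_Cons)
  qed
qed simp

section \<open>Counting\<close>

lemma setA_word_value:
  assumes "admissible w" "word_value w > 0"
  shows "word_value w \<in> setA \<longleftrightarrow> (\<exists>z. ends_one_zeros w z \<and> z mod 3 \<noteq> 1)"
proof -
  have "z mod 3 \<noteq> 1 \<longleftrightarrow> (\<exists>s. z = 3 * s \<or> z = 3 * s + 2)" for z :: nat
    by presburger
  then show ?thesis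
    using assms by (auto simp: setA_def narayana_rep_word_value ends_one_zeros_dropWhile)
qed

lemma setB_word_value:
  assumes "admissible w" "word_value w > 0"
  shows "word_value w \<in> setB \<longleftrightarrow> (\<exists>z. ends_one_zeros w z \<and> z mod 3 = 1)"
proof -
  have "z mod 3 = 1 \<longleftrightarrow> (\<exists>s. z = 3 * s + 1)" for z :: nat
    by presburger
  then show ?thesis
    using assms by (auto simp: setB_def narayana_rep_word_value ends_one_zeros_dropWhile)
qed

text \<open>A positive number has exactly one count of trailing zeros, and the two sets separate
  these counts by their residue mod 3.\<close>

lemma setB_iff: "k \<in> setB \<longleftrightarrow> k > 0 \<and> k \<notin> setA"
proof (cases "k > 0")
  case True
  have "k < narayana k" by (rule less_narayana)
  then obtain w where w: "admissible w" "word_value w = k"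
    using word_value_exists by metis
  then obtain z where z: "ends_one_zeros w z" using ends_one_zeros_exists True by blast
  then have "ends_one_zeros w z' \<longleftrightarrow> z' = z" for z'
    using ends_one_zeros_unique by blast
  then show ?thesis
    using True setA_word_value[OF w(1)] setB_word_value[OF w(1)] w(2) by simp
qed (simp add: setB_def)

lemma narayana_in_setA_iff: "narayana n \<in> setA \<longleftrightarrow> n mod 3 \<noteq> 1"
proof -
  let ?w = "1 # replicate n 0"
  have "admissible ?w"
  proof -
    consider "n = 0" | "n = Suc 0" | m where "n = Suc (Suc m)"
      by (metis not0_implies_Suc)
    then show ?thesis
      using admissible_padded[of _ "[]"]
      by cases (auto simp: admissible_Cons_1 simp del: One_nat_def)
  qed
  moreover have "word_value ?w = narayana n" by simp
  ultimately show ?thesis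
    using setA_word_value[of ?w] by (auto simp: ends_one_zeros_Cons)
qed

text \<open>Prepending 100 to the \<open>n\<close>-digit word of \<open>m\<close> does not affect
  its last 1. For \<open>m = 0\<close> there is none, and the new 1 would decide the ending.\<close>

lemma narayana_add_in_setA_iff:
  assumes "0 < m" "m < narayana n"
  shows "narayana (n + 2) + m \<in> setA \<longleftrightarrow> m \<in> setA"
proof -
  obtain w where w: "admissible w" "length w = n" "word_value w = m"
    using word_value_exists[OF assms(2)] .
  let ?w = "1 # 0 # 0 # w"
  have "w \<noteq> replicate z 0" for z using w assms by auto
  moreover have "0 # 0 # w \<noteq> replicate z 0" for z
  proof
    assume "0 # 0 # w = replicate z 0"
    then have "word_value (0 # 0 # w) = 0" by (metis word_value_replicate_0)
    then show False using w assms by simp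
  qed
  ultimately have "ends_one_zeros ?w z \<longleftrightarrow> ends_one_zeros w z" for z
    by (auto simp: ends_one_zeros_Cons)
  then show ?thesis
    using setA_word_value[of w] setA_word_value[of ?w] w assms by (simp del: One_nat_def)
qed

section \<open>Ranks in the first set\<close>

definition rankA :: "nat \<Rightarrow> nat" where
  "rankA k = card {j \<in> setA. j \<le> k}"

lemma rankA_0 [simp]: "rankA 0 = 0"
  by (auto simp: rankA_def setA_def)

lemma rankA_Suc: "rankA (Suc k) = rankA k + of_bool (Suc k \<in> setA)"
proof -
  have "{j \<in> setA. j \<le> Suc k} =
      (if Suc k \<in> setA then insert (Suc k) {j \<in> setA. j \<le> k} else {j \<in> setA. j \<le> k})"
    by (auto simp: le_Suc_eq)
  then show ?thesis by (simp add: rankA_def)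
qed

lemma rankA_narayana_add:
  "m < narayana n \<Longrightarrow> rankA (narayana (n + 2) + m) = rankA (narayana (n + 2)) + rankA m"
proof (induction m)
  case (Suc m)
  then show ?case
    using narayana_add_in_setA_iff[of "Suc m" n] by (simp add: rankA_Suc)
qed simp

lemma rankA_narayana_rec:
  "rankA (narayana (n + 3)) = rankA (narayana (n + 2)) + rankA (narayana n)"
proof -
  \<comment> \<open>Additivity reaches only up to \<open>narayana n - 1\<close>. The last element on
    each side is compared separately: the indices \<open>n + 3\<close> and \<open>n\<close> agree
    mod 3.\<close>
  obtain m where m: "narayana n = Suc m"
    using narayana_pos gr0_implies_Suc by blast
  have eq: "narayana (n + 3) = Suc (narayana (n + 2) + m)"
    using m by (simp add: narayana_Suc_Suc_Suc_eq)
  have "rankA (narayana (n + 3)) = rankA (narayana (n + 2) + m) + of_bool ((n + 3) mod 3 \<noteq> 1)"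
    using rankA_Suc[of "narayana (n + 2) + m"] eq narayana_in_setA_iff[of "n + 3"] by simp
  moreover have "rankA (narayana n) = rankA m + of_bool (n mod 3 \<noteq> 1)"
    using rankA_Suc[of m] m narayana_in_setA_iff[of n] by simp
  moreover have "rankA (narayana (n + 2) + m) = rankA (narayana (n + 2)) + rankA m"
    using m by (intro rankA_narayana_add) simp
  ultimately show ?thesis by simp
qed

lemma rankA_narayana_initial:
  "rankA (narayana 0) = 1" "rankA (narayana 1) = 1" "rankA (narayana 2) = 2"
proof -
  have nar: "narayana 0 = Suc 0" "narayana 1 = Suc (Suc 0)" "narayana 2 = Suc (Suc (Suc 0))"
    by (simp_all add: numeral_2_eq_2)
  have "Suc 0 \<in> setA" "Suc (Suc 0) \<notin> setA" "Suc (Suc (Suc 0)) \<in> setA"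
    using narayana_in_setA_iff[of 0] narayana_in_setA_iff[of 1] narayana_in_setA_iff[of 2]
    unfolding nar by simp_all
  then show "rankA (narayana 0) = 1" "rankA (narayana 1) = 1" "rankA (narayana 2) = 2"
    unfolding nar by (simp_all add: rankA_Suc)
qed

section \<open>The discrepancy\<close>

lemma cubic_strict_mono:
  fixes x y :: real
  assumes "1 \<le> x" "x < y"
  shows "x ^ 3 - x ^ 2 < y ^ 3 - y ^ 2"
proof -
  have "x ^ 2 * (x - 1) < y ^ 2 * (y - 1)"
    using assms by (intro mult_strict_mono' power_strict_mono) auto
  then show ?thesis by (simp add: algebra_simps power2_eq_square power3_eq_cube)
qed

lemma cubic_root_ge_1:
  fixes x :: real
  assumes "x ^ 3 - x ^ 2 - 1 = 0"
  shows "1 \<le> x"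
proof (rule ccontr)
  assume "\<not> 1 \<le> x"
  then have "x ^ 2 * (x - 1) \<le> 0" by (intro mult_nonneg_nonpos) auto
  then show False using assms by (simp add: algebra_simps power2_eq_square power3_eq_cube)
qed

lemma alpha_root: "alpha ^ 3 - alpha ^ 2 - 1 = 0"
proof -
  have "\<exists>x\<ge>1. x \<le> 2 \<and> x ^ 3 - x ^ 2 - 1 = (0::real)"
    by (rule IVT') (auto intro!: continuous_intros)
  then obtain x :: real where x: "x ^ 3 - x ^ 2 - 1 = 0" by blast
  have "y = x" if "y ^ 3 - y ^ 2 - 1 = 0" for y :: real
    using cubic_strict_mono[of x y] cubic_strict_mono[of y x] x that
      cubic_root_ge_1[of x] cubic_root_ge_1[of y] by (cases x y rule: linorder_cases) auto
  then have "\<exists>!x::real. x ^ 3 - x ^ 2 - 1 = 0" using x by blast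
  then show ?thesis unfolding alpha_def by (rule theI')
qed

lemma alpha_bounds: "1.4655712318 \<le> alpha" "alpha \<le> 1.4655712319"
proof -
  have ge: "1 \<le> alpha" using alpha_root by (rule cubic_root_ge_1)
  show "alpha \<le> 1.4655712319"
  proof (rule ccontr)
    assume "\<not> ?thesis"
    then show False
      using alpha_root cubic_strict_mono[of "1.4655712319" alpha]
      by (simp add: power2_eq_square power3_eq_cube)
  qed
  show "1.4655712318 \<le> alpha"
  proof (rule ccontr)
    assume "\<not> ?thesis"
    then show False
      using ge alpha_root cubic_strict_mono[of alpha "1.4655712318"]
      by (simp add: power2_eq_square power3_eq_cube)
  qed
qed

lemma alpha_square_bounds: "2.14789 \<le> alpha ^ 2" "alpha ^ 2 \<le> 2.1479"
proof -
  have "1.4655712318 ^ 2 \<le> alpha ^ 2" "alpha ^ 2 \<le> 1.4655712319 ^ 2"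
    using alpha_bounds by (intro power_mono; simp)+
  then show "2.14789 \<le> alpha ^ 2" "alpha ^ 2 \<le> 2.1479"
    by (simp_all add: power2_eq_square)
qed

section \<open>Discrepancies at Narayana numbers and their decay\<close>

definition discr :: "nat \<Rightarrow> real" where
  "discr k = real k - alpha * real (rankA k)"

lemma discr_0 [simp]: "discr 0 = 0"
  by (simp add: discr_def)

lemma discr_narayana_add:
  "m < narayana n \<Longrightarrow> discr (narayana (n + 2) + m) = discr (narayana (n + 2)) + discr m"
  by (simp only: discr_def rankA_narayana_add of_nat_add ring_distribs)

text \<open>A parameter \<open>x\<close> replaces \<open>alpha\<close> so that terms can be
  evaluated at rational endpoints. As a function of \<open>x\<close>, the \<open>n\<close>-th term
  is the affine expression \<open>narayana n - x * rankA (narayana n)\<close>.\<close>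

fun lin_rec :: "real \<Rightarrow> nat \<Rightarrow> real" where
  "lin_rec x 0 = 1 - x"
| "lin_rec x (Suc 0) = 2 - x"
| "lin_rec x (Suc (Suc 0)) = 3 - 2 * x"
| "lin_rec x (Suc (Suc (Suc n))) = lin_rec x (Suc (Suc n)) + lin_rec x n"

lemma lin_rec_antimono: "x \<le> y \<Longrightarrow> lin_rec y n \<le> lin_rec x n"
  by (induction x n rule: lin_rec.induct) (simp_all add: add_mono)

lemma discr_narayana: "discr (narayana n) = lin_rec alpha n"
proof (induction n rule: narayana.induct)
  case 1
  show ?case unfolding discr_def rankA_narayana_initial(1) by simp
next
  case 2
  show ?case unfolding discr_def rankA_narayana_initial(2)[unfolded One_nat_def] by simp
next
  case 3
  show ?case unfolding discr_def rankA_narayana_initial(3)[unfolded numeral_2_eq_2] by simp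
next
  case (4 n)
  have "discr (narayana (n + 3)) = discr (narayana (n + 2)) + discr (narayana n)"
    by (simp only: discr_def narayana_Suc_Suc_Suc_eq[of n] rankA_narayana_rec[unfolded narayana_Suc_Suc_Suc_eq])
      (simp add: algebra_simps)
  then show ?case using 4 by (simp add: numeral_3_eq_3)
qed

text \<open>The characteristic polynomial factors as $(X-\alpha)(X^2+(\alpha-1)X+1/\alpha)$, and the
  component along $\alpha$ vanishes.\<close>

lemma lin_rec_alpha_order_two:
  "lin_rec alpha (n + 2) = - (alpha - 1) * lin_rec alpha (n + 1) - lin_rec alpha n / alpha"
proof -
  have pos: "alpha > 0" using alpha_bounds by simp
  have inv: "1 / alpha = alpha ^ 2 - alpha"
    using alpha_root pos by (simp add: field_simps power2_eq_square power3_eq_cube)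
  have "lin_rec alpha (Suc (Suc n)) =
      - (alpha - 1) * lin_rec alpha (Suc n) - (alpha ^ 2 - alpha) * lin_rec alpha n"
  proof (induction n)
    case 0
    then show ?case using alpha_root by (simp add: algebra_simps power2_eq_square power3_eq_cube)
  next
    case (Suc n)
    have c: "alpha * (alpha ^ 2 - alpha) = 1"
      using alpha_root by (simp add: algebra_simps power2_eq_square power3_eq_cube)
    \<comment> \<open>After the third-order recurrence is inserted, the goal becomes the induction
      hypothesis multiplied by \<open>alpha\<close>.\<close>
    have "alpha * lin_rec alpha (Suc (Suc n)) = - (alpha ^ 2 - alpha) * lin_rec alpha (Suc n)
        - (alpha * (alpha ^ 2 - alpha)) * lin_rec alpha n"
      unfolding Suc by (simp add: algebra_simps power2_eq_square)
    then show ?case unfolding c by (simp add: algebra_simps)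
  qed
  moreover have "lin_rec alpha n / alpha = (alpha ^ 2 - alpha) * lin_rec alpha n"
    unfolding inv[symmetric] by simp
  ultimately show ?thesis by simp
qed

text \<open>The form $y^2+(\alpha-1)xy+x^2/\alpha$ in two consecutive terms $x,y$ is positive definite and
  shrinks by the factor $1/\alpha$ in each step.\<close>

lemma abs_lin_rec_alpha_le: "\<bar>lin_rec alpha n\<bar> \<le> 0.72 * 0.8261 ^ n"
proof -
  let ?d = "lin_rec alpha"
  define b where "b = 1 / alpha"
  define Q where "Q = (\<lambda>n. ?d (n + 1) ^ 2 + (alpha - 1) * ?d n * ?d (n + 1) + b * ?d n ^ 2)"
  have pos: "alpha > 0" using alpha_bounds by simp
  have b: "b = alpha ^ 2 - alpha"
    using alpha_root pos by (simp add: b_def field_simps power2_eq_square power3_eq_cube)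
  have b_bounds: "0.682 \<le> b" "b \<le> 0.8261 ^ 2"
    using alpha_bounds alpha_square_bounds b by (simp_all add: power2_eq_square)
  have Q_Suc: "Q (Suc n) = b * Q n" for n
  proof -
    have "?d (n + 2) = - (alpha - 1) * ?d (n + 1) - b * ?d n"
      using lin_rec_alpha_order_two[of n] by (simp add: b_def)
    moreover have "y ^ 2 + (alpha - 1) * x * y + b * x ^ 2 = b * (x ^ 2 + (alpha - 1) * u * x + b * u ^ 2)"
      if "y = - (alpha - 1) * x - b * u" for x y u
      unfolding that by (simp add: algebra_simps power2_eq_square)
    ultimately show ?thesis by (simp add: Q_def)
  qed
  \<comment> \<open>Splitting off multiples of the cubic leaves 1 + \<alpha> - \<alpha>^2, about
    0.3177.\<close>
  have "Q 0 = (2 - alpha) ^ 2 - (alpha - 1) ^ 2 * (2 - alpha) + (alpha ^ 2 - alpha) * (alpha - 1) ^ 2"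
    by (simp add: Q_def b algebra_simps power2_eq_square)
  also have "\<dots> = alpha * (alpha ^ 3 - alpha ^ 2 - 1) - (alpha ^ 3 - alpha ^ 2 - 1) + 1 + alpha - alpha ^ 2"
    by (simp add: algebra_simps power2_eq_square power3_eq_cube)
  finally have Q0: "Q 0 \<le> 0.3178"
    using alpha_root alpha_bounds alpha_square_bounds by simp
  have Q_le: "Q n \<le> 0.3178 * b ^ n" for n
  proof (induction n)
    case (Suc n)
    have "b * Q n \<le> b * (0.3178 * b ^ n)"
      using Suc b_bounds by (intro mult_left_mono) auto
    then show ?case by (simp add: Q_Suc algebra_simps)
  qed (use Q0 in simp)
  \<comment> \<open>Completing the square in \<open>?d (n + 1)\<close> leaves the coefficient
    \<open>b - (alpha - 1) ^ 2 / 4\<close>, about 0.628. The final constants come from 0.3178 \<le>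
    0.62 * 0.72^2 and from 0.8261 lying just above \<alpha>^(-1/2).\<close>
  have "0.62 * ?d n ^ 2 \<le> (b - (alpha - 1) ^ 2 / 4) * ?d n ^ 2"
  proof (rule mult_right_mono)
    have "(alpha - 1) ^ 2 = alpha ^ 2 - 2 * alpha + 1" by (simp add: power2_diff)
    then show "0.62 \<le> b - (alpha - 1) ^ 2 / 4"
      using alpha_bounds alpha_square_bounds b by (simp add: field_simps)
  qed simp
  also have "\<dots> \<le> (?d (n + 1) + (alpha - 1) / 2 * ?d n) ^ 2 + (b - (alpha - 1) ^ 2 / 4) * ?d n ^ 2"
    by simp
  also have "\<dots> = Q n"
    by (simp add: Q_def algebra_simps power2_eq_square add_divide_distrib diff_divide_distrib)
  also have "\<dots> \<le> 0.3178 * b ^ n" by (rule Q_le)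
  also have "\<dots> \<le> 0.3178 * (0.8261 ^ 2) ^ n"
    using b_bounds by (intro mult_left_mono power_mono) auto
  also have "\<dots> \<le> 0.62 * (0.72 ^ 2 * (0.8261 ^ 2) ^ n)"
    by (simp add: power2_eq_square)
  also have "\<dots> = 0.62 * (0.72 * 0.8261 ^ n) ^ 2"
    by (simp only: power_mult_distrib power_mult[symmetric] mult.commute[of 2 n])
  finally have "?d n ^ 2 \<le> (0.72 * 0.8261 ^ n) ^ 2" by simp
  then show ?thesis using abs_le_square_iff[of "?d n" "0.72 * 0.8261 ^ n"] by simp
qed

text \<open>Here \<open>x, y, z\<close> are the weights of three consecutive digit positions, and \<open>p, q, r\<close> bound
  the weighted digit sums over the words that only use positions below the respective one.\<close>

fun iterate_bound :: "nat \<Rightarrow> real \<Rightarrow> real \<Rightarrow> real \<Rightarrow> real \<Rightarrow> real \<Rightarrow> real \<Rightarrow> real" where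
  "iterate_bound 0 x y z p q r = p"
| "iterate_bound (Suc k) x y z p q r = iterate_bound k y z (z + x) q r (max r (p + z))"

section \<open>Bounds for functions additive over the digits\<close>

lemma narayana_split:
  assumes "m < narayana (n + 3)"
  obtains "m < narayana (n + 2)" | m' where "m = narayana (n + 2) + m'" "m' < narayana n"
  using assms narayana_Suc_Suc_Suc_eq[of n]
  by (cases "m < narayana (n + 2)") (auto simp: not_less le_iff_add)

text \<open>Using position \<open>n + 2\<close> leaves only positions below \<open>n\<close>, which
  gives the alternative \<open>p + z\<close>; not using it gives \<open>r\<close>. Each induction
  step shifts the window by one position. Since \<open>v\<close> need only dominate
  \<open>G\<close>, rational weights may replace the exact ones.\<close>

lemma additive_le_iterate_bound:
  fixes G :: "nat \<Rightarrow> real"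
  assumes add: "\<And>n m. m < narayana n \<Longrightarrow> G (narayana (n + 2) + m) = G (narayana (n + 2)) + G m"
    and G_le: "\<And>n. G (narayana n) \<le> v n"
    and v_rec: "\<And>n. v (n + 3) = v (n + 2) + v n"
    and "\<And>m. m < narayana n \<Longrightarrow> G m \<le> p"
    and "\<And>m. m < narayana (n + 1) \<Longrightarrow> G m \<le> q"
    and "\<And>m. m < narayana (n + 2) \<Longrightarrow> G m \<le> r"
    and "m < narayana (n + k)"
  shows "G m \<le> iterate_bound k (v n) (v (n + 1)) (v (n + 2)) p q r"
  using assms(4-7)
proof (induction k arbitrary: n p q r)
  case (Suc k)
  have "G m' \<le> max r (p + v (n + 2))" if "m' < narayana (Suc n + 2)" for m'
  proof -
    have "m' < narayana (n + 3)" using that by (simp add: numeral_3_eq_3)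
    then show ?thesis
    proof (cases rule: narayana_split)
      case 1
      then show ?thesis using Suc.prems(3)[of m'] by simp
    next
      case (2 l)
      then show ?thesis using add[of l n] G_le[of "n + 2"] Suc.prems(1)[of l] by simp
    qed
  qed
  then have "G m \<le> iterate_bound k (v (Suc n)) (v (Suc n + 1)) (v (Suc n + 2)) q r (max r (p + v (n + 2)))"
    using Suc.prems by (intro Suc.IH) auto
  moreover have "v (Suc n + 2) = v (n + 2) + v n" using v_rec[of n] by (simp add: numeral_3_eq_3)
  ultimately show ?case by simp
qed simp

text \<open>A computed bound with slack \<open>C * \<rho> ^ L\<close> is propagated to all
  positions. Going from \<open>i\<close> to \<open>i + 3\<close> adds at most
  \<open>K * \<rho> ^ (i + 2)\<close>, and the condition on \<open>C\<close> makes the loss of slack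
  \<open>C * \<rho> ^ i - C * \<rho> ^ (i + 3)\<close> cover this.\<close>

lemma additive_less:
  fixes G :: "nat \<Rightarrow> real"
  assumes add: "\<And>n m. m < narayana n \<Longrightarrow> G (narayana (n + 2) + m) = G (narayana (n + 2)) + G m"
    and G_0: "G 0 = 0"
    and G_le: "\<And>n. G (narayana n) \<le> v n"
    and v_rec: "\<And>n. v (n + 3) = v (n + 2) + v n"
    and tail: "\<And>n. G (narayana n) \<le> K * \<rho> ^ n"
    and C: "K * \<rho> ^ 2 \<le> C * (1 - \<rho> ^ 3)" "C > 0" "0 < \<rho>" "\<rho> < 1"
    and bound: "iterate_bound (L + 2) (v 0) (v 1) (v 2) 0 (max 0 (v 0)) (max 0 (max (v 0) (v 1)))
        \<le> c - C * \<rho> ^ L"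
  shows "G m < c"
proof -
  have small: "m < 3 \<Longrightarrow> m = 0 \<or> m = 1 \<or> m = 2" for m :: nat by auto
  have G_12: "G 1 \<le> v 0" "G 2 \<le> v 1" using G_le[of 0] G_le[of 1] by simp_all
  \<comment> \<open>The induction goes back three positions. This one estimate, with the largest
    slack, serves all three starting cases.\<close>
  have base: "G m \<le> c - C * \<rho> ^ L" if "m < narayana (L + 2)" for m
  proof -
    have "G m \<le> iterate_bound (L + 2) (v 0) (v (0 + 1)) (v (0 + 2)) 0 (max 0 (v 0))
        (max 0 (max (v 0) (v 1)))"
    proof (rule additive_le_iterate_bound[OF add G_le v_rec])
      show "G m \<le> 0" if "m < narayana 0" for m
        using that G_0 by simp
      show "G m \<le> max 0 (v 0)" if "m < narayana (0 + 1)" for m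
        using that G_0 G_12 small[of m] by auto
      show "G m \<le> max 0 (max (v 0) (v 1))" if "m < narayana (0 + 2)" for m
        using that G_0 G_12 small[of m] by (auto simp: numeral_2_eq_2 numeral_3_eq_3)
    qed (use that in simp_all)
    then show ?thesis using bound unfolding add_0 by (rule order_trans)
  qed
  have decr: "C * \<rho> ^ (i + j) \<le> C * \<rho> ^ i" for i j
    using C(2-4) by (intro mult_left_mono power_decreasing) simp_all
  have mono: "narayana i \<le> narayana (i + j)" for i j
    using strict_mono_narayana by (simp add: strict_mono_less_eq)
  have "m < narayana (L + n) \<longrightarrow> G m \<le> c - C * \<rho> ^ (L + n)" for n m
  proof (induction n arbitrary: m rule: less_induct)
    case (less n)
    show ?case
    proof (cases "n < 3")
      case True
      then have "narayana (L + n) \<le> narayana (L + 2)"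
        using mono[of "L + n" "2 - n"] by simp
      then show ?thesis using base[of m] decr[of L n] by auto
    next
      case False
      then obtain k where k: "n = k + 3" using le_Suc_ex[of 3 n] by (auto simp: add.commute)
      show ?thesis
      proof
        assume "m < narayana (L + n)"
        then have "m < narayana ((L + k) + 3)" using k by (simp add: algebra_simps)
        then show "G m \<le> c - C * \<rho> ^ (L + n)"
        proof (cases rule: narayana_split)
          case 1
          then have "G m \<le> c - C * \<rho> ^ (L + (k + 2))"
            using less.IH[of "k + 2" m] k by (simp add: algebra_simps)
          then show ?thesis using decr[of "L + (k + 2)" 1] k
            by (simp add: algebra_simps numeral_3_eq_3)
        next
          case (2 l)
          have "G l \<le> c - C * \<rho> ^ (L + k)" using less.IH[of k l] k 2 by simp
          moreover have "G m = G (narayana (L + k + 2)) + G l"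
            using 2 add[of l "L + k"] by simp
          moreover have "G (narayana (L + k + 2)) \<le> K * \<rho> ^ (L + k + 2)" by (rule tail)
          moreover have "\<rho> ^ (L + k) * (K * \<rho> ^ 2) \<le> \<rho> ^ (L + k) * (C * (1 - \<rho> ^ 3))"
            using C by (intro mult_left_mono) auto
          ultimately show ?thesis
            using k by (simp add: power_add power2_eq_square algebra_simps)
        qed
      qed
    qed
  qed
  moreover have "m < narayana (L + m)"
    using less_narayana[of "L + m"] by simp
  ultimately have "G m \<le> c - C * \<rho> ^ (L + m)" by blast
  also have "\<dots> < c" using C by simp
  finally show ?thesis .
qed

lemma lin_rec_rec: "lin_rec x (n + 3) = lin_rec x (n + 2) + lin_rec x n"
  by (simp add: numeral_3_eq_3)

text \<open>As \<open>lin_rec\<close> is antimonotone in \<open>x\<close>, the lower endpoint for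
  \<open>alpha\<close> yields upper weights. The constant 1.127 lies just above 0.72 * 0.8261^2 / (1
  - 0.8261^3).\<close>

lemma discr_less: "discr k < 1.0466"
proof (rule additive_less[where v = "lin_rec 1.4655712318" and K = "0.72" and \<rho> = "0.8261"
      and C = "1.127" and L = 28])
  show "discr (narayana (n + 2) + m) = discr (narayana (n + 2)) + discr m" if "m < narayana n" for n m
    using that by (rule discr_narayana_add)
  show "discr (narayana n) \<le> lin_rec 1.4655712318 n" for n
    using alpha_bounds by (simp add: discr_narayana lin_rec_antimono)
  show "discr (narayana n) \<le> 0.72 * 0.8261 ^ n" for n
    using abs_lin_rec_alpha_le[of n] by (simp add: discr_narayana)
qed (simp_all add: lin_rec_rec numeral_eq_Suc max_def)

lemma discr_greater: "- 1.2598 < discr k"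
proof -
  have "- discr k < 1.2598"
  proof (rule additive_less[where v = "\<lambda>n. - lin_rec 1.4655712319 n" and K = "0.72"
        and \<rho> = "0.8261" and C = "1.127" and L = 28])
    show "- discr (narayana (n + 2) + m) = - discr (narayana (n + 2)) + - discr m"
      if "m < narayana n" for n m
      using discr_narayana_add[OF that] by simp
    show "- discr (narayana n) \<le> - lin_rec 1.4655712319 n" for n
      using alpha_bounds by (simp add: discr_narayana lin_rec_antimono)
    show "- discr (narayana n) \<le> 0.72 * 0.8261 ^ n" for n
      using abs_lin_rec_alpha_le[of n] by (simp add: discr_narayana)
  qed (simp_all add: lin_rec_rec numeral_eq_Suc max_def)
  then show ?thesis by simp
qed

section \<open>The two sequences\<close>

lemma card_le_enumerate:
  fixes S :: "nat set"
  assumes "infinite S"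
  shows "card {j \<in> S. j \<le> enumerate S n} = Suc n"
proof -
  have "{j \<in> S. j \<le> enumerate S n} = enumerate S ` {..n}"
    using assms enumerate_in_set[OF assms] enumerate_Ex[OF assms] by (force simp: image_iff)
  moreover have "inj_on (enumerate S) {..n}"
    using inj_enumerate[OF assms] by (rule inj_on_subset) simp
  ultimately show ?thesis by (simp add: card_image)
qed

text \<open>Infinitude makes \<open>enumerate\<close> meaningful; each set contains all Narayana
  numbers with index in a suitable class mod 3.\<close>

lemma infinite_narayana_subsequence:
  assumes "\<And>n. narayana (3 * n + i) \<in> S"
  shows "infinite S"
proof -
  have "inj (\<lambda>n. narayana (3 * n + i))"
    by (simp add: inj_def strict_mono_eq[OF strict_mono_narayana])
  then have "infinite (range (\<lambda>n. narayana (3 * n + i)))" by (rule range_inj_infinite)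
  then show ?thesis using assms by (meson finite_subset image_subsetI)
qed

lemma infinite_setA: "infinite setA"
  by (rule infinite_narayana_subsequence[of 0]) (simp add: narayana_in_setA_iff)

lemma infinite_setB: "infinite setB"
  by (rule infinite_narayana_subsequence[of 1])
    (simp add: setB_iff narayana_in_setA_iff del: One_nat_def)

lemma rankA_plus_card_setB: "rankA k + card {j \<in> setB. j \<le> k} = k"
proof -
  have "{j \<in> setA. j \<le> k} \<union> {j \<in> setB. j \<le> k} = {1..k}"
    by (auto simp: setB_iff setA_def)
  moreover have "card ({j \<in> setA. j \<le> k} \<union> {j \<in> setB. j \<le> k}) =
      rankA k + card {j \<in> setB. j \<le> k}"
    unfolding rankA_def by (rule card_Un_disjoint) (auto simp: setB_iff)
  ultimately show ?thesis by simp
qed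

lemma rankA_seqA: "i \<ge> 1 \<Longrightarrow> rankA (seqA i) = i"
  using card_le_enumerate[OF infinite_setA, of "i - 1"] by (simp add: rankA_def seqA_def)

lemma rankA_seqB: "i \<ge> 1 \<Longrightarrow> rankA (seqB i) + i = seqB i"
  using card_le_enumerate[OF infinite_setB, of "i - 1"] rankA_plus_card_setB[of "seqB i"]
  by (simp add: seqB_def)

text \<open>The general bound is applied to the predecessor, from which \<open>discr\<close> changes
  by 1 - \<alpha>.\<close>

lemma discr_setA_less:
  assumes "k \<in> setA"
  shows "discr k < 2.0466 - alpha"
proof -
  obtain l where "k = Suc l" using assms by (cases k) (auto simp: setA_def)
  then have "discr k = discr l + 1 - alpha"
    using assms by (simp add: discr_def rankA_Suc algebra_simps)
  then show ?thesis using discr_less[of l] by simp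
qed

lemma discr_setB_greater:
  assumes "k \<in> setB"
  shows "- 0.2598 < discr k"
proof -
  obtain l where "k = Suc l" using assms by (cases k) (auto simp: setB_iff)
  then have "discr k = discr l + 1"
    using assms by (simp add: discr_def rankA_Suc setB_iff)
  then show ?thesis using discr_greater[of l] by simp
qed

theorem theorem26:
  shows "(\<forall>i::nat. i \<ge> 1 \<longrightarrow>
            -1.2630921 < real (seqA i) - alpha * real i \<and>
            real (seqA i) - alpha * real i < 0.58304372) \<and>
         (\<forall>i::nat. i \<ge> 1 \<longrightarrow>
            -2.2480941 < real (seqB i) - alpha ^ 3 * real i \<and>
            real (seqB i) - alpha ^ 3 * real i < 0.558039)"
proof (intro conjI allI impI)
  fix i :: nat assume i: "i \<ge> 1"
  have A: "seqA i \<in> setA"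
    unfolding seqA_def by (rule enumerate_in_set[OF infinite_setA])
  have eqA: "real (seqA i) - alpha * real i = discr (seqA i)"
    unfolding discr_def rankA_seqA[OF i] ..
  show "-1.2630921 < real (seqA i) - alpha * real i"
    using discr_greater[of "seqA i"] eqA by simp
  show "real (seqA i) - alpha * real i < 0.58304372"
    using discr_setA_less[OF A] eqA alpha_bounds by simp
  have B: "seqB i \<in> setB"
    unfolding seqB_def by (rule enumerate_in_set[OF infinite_setB])
  \<comment> \<open>With k = \<open>seqB i\<close> and r = \<open>rankA k\<close>, the error is k -
    \<alpha>^3 (k - r) = -\<alpha>^2 (k - \<alpha> r). The negative factor exchanges upper and lower
    bounds.\<close>
  have "real i = real (seqB i) - real (rankA (seqB i))" using rankA_seqB[OF i] by linarith
  moreover have "alpha ^ 3 = alpha ^ 2 + 1" using alpha_root by simp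
  ultimately have eqB: "real (seqB i) - alpha ^ 3 * real i = - (alpha ^ 2) * discr (seqB i)"
    unfolding discr_def by algebra
  have "alpha ^ 2 * discr (seqB i) < alpha ^ 2 * 1.0466"
    using discr_less[of "seqB i"] alpha_square_bounds by (intro mult_strict_left_mono) auto
  then show "-2.2480941 < real (seqB i) - alpha ^ 3 * real i"
    using eqB alpha_square_bounds by simp
  have "alpha ^ 2 * (- discr (seqB i)) < alpha ^ 2 * 0.2598"
    using discr_setB_greater[OF B] alpha_square_bounds by (intro mult_strict_left_mono) auto
  then show "real (seqB i) - alpha ^ 3 * real i < 0.558039"
    using eqB alpha_square_bounds by simp
qed

end
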